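(* The map $\tilde{U}:\mathbb{Z}_2\to S$ defined in the context is well-defined everywhere (that is, the value $\tilde{U}(\tilde y)(x,z)$ does not depend on the choices made in its definition) and is continuous at every $y\in\mathbb{Z}_2\setminus\mathbb{N}$, where $\mathbb{Z}_2$ carries the $2$-adic topology and $S$ the topology of $\rho$.
   Context: $\mathbb{N}=\{0,1,2,\dots\}$, and $\mathbb{Z}_2$ is the ring of $2$-adic integers, containing $\mathbb{N}$. Ulam words are binary words defined recursively: $\mathcal{U}(1)=\{0,1\}$, and for $n>1$, $\mathcal{U}(n)$ is the set of all words of length $n$ over $\{0,1\}$ that are expressible uniquely as a concatenation $uv$ of two distinct words $u\in\mathcal{U}(i)$, $v\in\mathcal{U}(j)$ with $i,j<n$ (i.e. there is exactly one ordered pair $(u,v)$ of such words, $u\ne v$). A word is Ulam if it belongs to $\bigcup_{n\ge1}\mathcal{U}(n)$. For an integer $y\ge0$, $\text{c-Ulam}[y]:\mathbb{N}^2\to\{0,1,2\}$ is defined by letting $\text{c-Ulam}[y](x,z)$ be the minimum of $2$ and the number of representations of $0^x10^y10^z$ as a concatenation of two (not necessarily distinct) Ulam words with exactly one $1$ each, i.e. the number of integers $a$, $0\le a\le y$, such that both $0^x10^a$ and $0^{y-a}10^z$ are Ulam. Let $Q=\mathbb{N}\times\{-1,-2,-3,\dots\}\subset\mathbb{Z}^2$, and let $S$ be the set of labelings $Q\to\{0,1,2\}$, with metric $\rho(L_1,L_2)=\frac1d$, where $d$ is the largest integer (perhaps $\infty$) such that $L_1(m,n)=L_2(m,n)$ for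 all $(m,n)\in Q$ with $m,|n|\le d$ (conventions: $1/\infty=0$, $1/0=\infty$). Definition of $\tilde{U}$. For an integer $y\ge1$ with $2^k\le y<2^{k+1}$, set $\tilde{U}(y)(x,z)=\text{c-Ulam}[y](x,z')$ for $(x,z)\in Q$, where $z'$ is any integer with $z'\equiv z\pmod{2^{k+1}}$ and $z'\ge0$; for $y=0$, $\tilde{U}(0)$ is the constant labeling $1$ (the labeling $\text{c-Ulam}[0]$ being constantly $1$). For $\tilde{y}\in\mathbb{Z}_2\setminus\mathbb{N}$ and $(x,z)\in Q$, set $\tilde{U}(\tilde{y})(x,z)=\tilde{U}(y')(x,z)$ for any $y'\in\mathbb{N}$ with $y'\ge x$, $y'\ge|z|$ and such that $\tilde{y}\equiv y'\pmod{2^{k+1}}$ for some $k$ with $2^{k+1}>y'$ (such a $y'$ exists because the binary expansion of $\tilde{y}$ has infinitely many $1$'s). *)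

theory Defs
  imports
    "HOL-Analysis.Analysis"
    "HOL-Library.Z2"
    "HOL-Number_Theory.Cong"
begin

section \<open>Ulam words\<close>

text \<open>Words are lists over the two-element type \<^typ>\<open>bit\<close>. The bounded quantifiers over lengths
  let termination be proved.\<close>

function ulam :: "nat \<Rightarrow> bit list set" where
  "ulam n =
     (if n = 0 then {}
      else if n = 1 then {[0], [1]}
      else {w. length w = n \<and>
               (\<exists>!(u, v). (\<exists>i\<in>{1..<n}. u \<in> ulam i) \<and> (\<exists>j\<in>{1..<n}. v \<in> ulam j) \<and>
                         u \<noteq> v \<and> w = u @ v)})"
  by pat_completeness auto
termination by (relation "Wellfounded.measure id") auto

declare ulam.simps [simp del]

definition is_ulam :: "bit list \<Rightarrow> bool" where
  "is_ulam w \<longleftrightarrow> w \<in> (\<Union>n\<in>{1..}. ulam n)"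

definition c_ulam :: "nat \<Rightarrow> nat \<Rightarrow> nat \<Rightarrow> nat" where
  "c_ulam y x z = min 2 (card {(u, v). is_ulam u \<and> is_ulam v \<and>
     count_list u 1 = 1 \<and> count_list v 1 = 1 \<and>
     u @ v = replicate x 0 @ [1] @ replicate y 0 @ [1] @ replicate z 0})"

section \<open>The 2-adic integers\<close>

text \<open>The inverse limit of the rings of integers modulo \<open>2 ^ n\<close>; the condition also forces
  \<open>0 \<le> f n < 2 ^ n\<close>.\<close>

typedef two_adic = "{f :: nat \<Rightarrow> int. \<forall>n. f n = f (Suc n) mod 2 ^ n}"
  morphisms residue Abs_two_adic
  by (rule exI[of _ "\<lambda>_. 0"]) simp

setup_lifting type_definition_two_adic

lemma mod_pow2_Suc: "(a mod 2 ^ Suc n) mod 2 ^ n = a mod (2 ^ n :: int)"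
  by (rule mod_mod_cancel) simp

lemma coherent_mod:
  "\<forall>n. f n = f (Suc n) mod 2 ^ n \<Longrightarrow> f n mod 2 ^ n = f (Suc n) mod (2 ^ n :: int)"
  by (metis mod_mod_trivial)

instantiation two_adic :: comm_ring_1
begin

lift_definition zero_two_adic :: two_adic is "\<lambda>_. 0" by simp

lift_definition one_two_adic :: two_adic is "\<lambda>n. 1 mod 2 ^ n"
  by (simp (no_asm) only: mod_pow2_Suc)

lift_definition plus_two_adic :: "two_adic \<Rightarrow> two_adic \<Rightarrow> two_adic"
  is "\<lambda>f g n. (f n + g n) mod 2 ^ n"
  by (simp (no_asm) only: mod_pow2_Suc) (blast intro: mod_add_cong coherent_mod)

lift_definition minus_two_adic :: "two_adic \<Rightarrow> two_adic \<Rightarrow> two_adic"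
  is "\<lambda>f g n. (f n - g n) mod 2 ^ n"
  by (simp (no_asm) only: mod_pow2_Suc) (blast intro: mod_diff_cong coherent_mod)

lift_definition uminus_two_adic :: "two_adic \<Rightarrow> two_adic"
  is "\<lambda>f n. (- f n) mod 2 ^ n"
  by (simp (no_asm) only: mod_pow2_Suc) (blast intro: mod_minus_cong coherent_mod)

lift_definition times_two_adic :: "two_adic \<Rightarrow> two_adic \<Rightarrow> two_adic"
  is "\<lambda>f g n. (f n * g n) mod 2 ^ n"
  by (simp (no_asm) only: mod_pow2_Suc) (blast intro: mod_mult_cong coherent_mod)

lemma residue_0 [simp]: "residue 0 n = 0"
  by transfer (simp (no_asm))

lemma residue_1: "residue 1 n = 1 mod 2 ^ n"
  by transfer (simp (no_asm))

lemma residue_add: "residue (x + y) n = (residue x n + residue y n) mod 2 ^ n"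
  by transfer (simp (no_asm))

lemma residue_diff: "residue (x - y) n = (residue x n - residue y n) mod 2 ^ n"
  by transfer (simp (no_asm))

lemma residue_minus: "residue (- x) n = (- residue x n) mod 2 ^ n"
  by transfer (simp (no_asm))

lemma residue_mult: "residue (x * y) n = (residue x n * residue y n) mod 2 ^ n"
  by transfer (simp (no_asm))

lemma residue_mod [simp]: "residue x n mod 2 ^ n = residue x n"
  by transfer (metis mod_mod_trivial)

lemma two_adic_eqI: "(\<And>n. residue x n = residue y n) \<Longrightarrow> x = y"
  by (metis residue_inject ext)

instance
proof
  fix a b c :: two_adic
  show "a * b * c = a * (b * c)"
    by (rule two_adic_eqI) (simp add: residue_mult mod_simps mult.assoc)
  show "a * b = b * a"
    by (rule two_adic_eqI) (simp add: residue_mult mult.commute)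
  show "1 * a = a"
    by (rule two_adic_eqI) (simp only: residue_mult residue_1 mod_mult_left_eq mult_1 residue_mod)
  show "a + b + c = a + (b + c)"
    by (rule two_adic_eqI) (simp add: residue_add mod_simps add.assoc)
  show "a + b = b + a"
    by (rule two_adic_eqI) (simp add: residue_add add.commute)
  show "0 + a = a"
    by (rule two_adic_eqI) (simp add: residue_add)
  show "- a + a = 0"
    by (rule two_adic_eqI) (simp add: residue_add residue_minus mod_simps)
  show "a - b = a + - b"
    by (rule two_adic_eqI) (simp add: residue_add residue_diff residue_minus mod_simps)
  show "(a + b) * c = a * c + b * c"
    by (rule two_adic_eqI) (simp add: residue_add residue_mult mod_simps distrib_right)
  have "residue 0 1 \<noteq> residue 1 1"
    by (simp add: residue_1)
  then show "(0::two_adic) \<noteq> 1"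
    by metis
qed

end

lemma residue_of_nat: "residue (of_nat m) n = int m mod 2 ^ n"
proof (induction m)
  case (Suc m)
  then show ?case
    by (simp only: of_nat_Suc residue_add residue_1 mod_add_eq)
qed simp

lemma residue_le: "m \<le> n \<Longrightarrow> residue x n mod 2 ^ m = residue x m"
proof (induction n rule: dec_induct)
  case (step n)
  have "residue x n = residue x (Suc n) mod 2 ^ n"
    by transfer blast
  then show ?case
    using step by (metis mod_mod_cancel le_imp_power_dvd)
qed simp

lemma pow2_dvd_iff: "2 ^ n dvd x \<longleftrightarrow> residue x n = 0"
proof
  have pow: "(2 ^ n :: two_adic) = of_nat (2 ^ n)"
    by simp
  {
    assume "2 ^ n dvd x"
    then obtain c where "x = of_nat (2 ^ n) * c"
      unfolding pow by (auto elim: dvdE)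
    then show "residue x n = 0"
      by (simp only: residue_mult residue_of_nat) simp
  next
    assume 0: "residue x n = 0"
    define f where "f k = residue x (k + n) div 2 ^ n" for k
    have dvd: "2 ^ n dvd residue x (k + n)" for k
      using residue_le[of n "k + n" x] 0 by (simp add: dvd_eq_mod_eq_0)
    have "f k = f (Suc k) mod 2 ^ k" for k
    proof -
      have "residue x (k + n) = residue x (Suc k + n) mod 2 ^ (k + n)"
        by (simp add: residue_le)
      also have "\<dots> = (2 ^ n * f (Suc k)) mod (2 ^ n * 2 ^ k)"
        using dvd[of "Suc k"] by (simp add: f_def power_add mult.commute)
      also have "\<dots> = 2 ^ n * (f (Suc k) mod 2 ^ k)"
        by (rule mult_mod_right[symmetric])
      finally show ?thesis
        by (simp add: f_def)
    qed
    then have res: "residue (Abs_two_adic f) = f"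
      by (intro Abs_two_adic_inverse CollectI allI)
    have "x = of_nat (2 ^ n) * Abs_two_adic f"
    proof (rule two_adic_eqI)
      fix k
      have "2 ^ n * f k = residue x (k + n)"
        using dvd[of k] by (simp add: f_def)
      then show "residue x k = residue (of_nat (2 ^ n) * Abs_two_adic f) k"
        by (simp only: residue_mult residue_of_nat res)
          (metis residue_le le_add1 mod_mult_left_eq of_nat_numeral of_nat_power)
    qed
    then show "2 ^ n dvd x"
      unfolding pow by (metis dvd_triv_left)
  }
qed

lemma pow2_dvd_diff_iff: "2 ^ n dvd x - y \<longleftrightarrow> residue x n = residue y n"
  by (metis pow2_dvd_iff residue_diff residue_mod mod_eq_dvd_iff dvd_eq_mod_eq_0)

instance two_adic :: ring_char_0
proof
  show "inj (of_nat :: nat \<Rightarrow> two_adic)"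
  proof (rule injI)
    fix a b :: nat
    assume "(of_nat a :: two_adic) = of_nat b"
    then have "int a mod 2 ^ (a + b) = int b mod 2 ^ (a + b)"
      by (metis residue_of_nat)
    moreover have "a < 2 ^ (a + b)" "b < 2 ^ (a + b)"
      by (meson le_add1 le_add2 less_exp order_le_less_trans)+
    then have "int a < 2 ^ (a + b)" "int b < 2 ^ (a + b)"
      by (simp_all flip: of_nat_less_iff)
    ultimately show "a = b"
      by simp
  qed
qed

lemma pow2_dvd_diff_iff_le:
  fixes x y :: two_adic
  assumes "x \<noteq> y"
  shows "2 ^ n dvd x - y \<longleftrightarrow> n \<le> (GREATEST n. 2 ^ n dvd x - y)"
proof -
  obtain b where b: "residue x b \<noteq> residue y b"
    using assms two_adic_eqI by blast
  have bound: "k \<le> b" if "2 ^ k dvd x - y" for k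
    using that b unfolding pow2_dvd_diff_iff by (metis residue_le nat_le_linear)
  have "2 ^ (GREATEST n. 2 ^ n dvd x - y) dvd x - y"
    by (rule GreatestI_nat[of _ 0 b]) (use bound in auto)
  then show ?thesis
    using bound by (meson Greatest_le_nat power_le_dvd)
qed

instantiation two_adic :: metric_space
begin

definition dist_two_adic :: "two_adic \<Rightarrow> two_adic \<Rightarrow> real" where
  "dist_two_adic x y = (if x = y then 0 else 1 / 2 ^ (GREATEST n. 2 ^ n dvd x - y))"

definition uniformity_two_adic :: "(two_adic \<times> two_adic) filter" where
  "uniformity_two_adic = (INF e\<in>{0<..}. principal {(x, y). dist x y < e})"

definition open_two_adic :: "two_adic set \<Rightarrow> bool" where
  "open_two_adic U \<longleftrightarrow> (\<forall>x\<in>U. \<forall>\<^sub>F (x', y) in uniformity. x' = x \<longrightarrow> y \<in> U)"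

lemma dist_two_adic_le_iff: "dist x y \<le> 1 / 2 ^ n \<longleftrightarrow> 2 ^ n dvd x - (y :: two_adic)"
proof (cases "x = y")
  case False
  then show ?thesis
    by (subst pow2_dvd_diff_iff_le) (simp_all add: dist_two_adic_def divide_simps)
qed (simp add: dist_two_adic_def)

instance
proof
  fix x y z :: two_adic
  show "dist x y = 0 \<longleftrightarrow> x = y"
    by (simp add: dist_two_adic_def)
  show "dist x y \<le> dist x z + dist y z"
  proof (cases "x = z \<or> y = z")
    case True
    have "2 ^ n dvd z - y \<longleftrightarrow> 2 ^ n dvd y - z" for n
      by (auto simp: pow2_dvd_diff_iff)
    with True show ?thesis
      by (auto simp: dist_two_adic_def)
  next
    case False
    define a where "a = (GREATEST n. 2 ^ n dvd x - z)"
    define b where "b = (GREATEST n. 2 ^ n dvd y - z)"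
    have "2 ^ min a b dvd x - z" "2 ^ min a b dvd y - z"
      using False pow2_dvd_diff_iff_le[of x z "min a b"] pow2_dvd_diff_iff_le[of y z "min a b"]
      by (simp_all add: a_def b_def)
    then have "2 ^ min a b dvd x - y"
      unfolding pow2_dvd_diff_iff by simp
    then have "dist x y \<le> 1 / 2 ^ min a b"
      by (simp add: dist_two_adic_le_iff)
    also have "\<dots> \<le> 1 / 2 ^ a + 1 / 2 ^ b"
      by (auto simp: min_def)
    finally show ?thesis
      using False by (simp add: dist_two_adic_def a_def b_def)
  qed
qed (simp_all only: uniformity_two_adic_def open_two_adic_def)

end

section \<open>Labelings\<close>

definition Q :: "(nat \<times> int) set" where
  "Q = UNIV \<times> {..-1}"

typedef labeling = "Q \<rightarrow>\<^sub>E {0, 1, 2 :: nat}"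
  morphisms label Abs_labeling
  by (rule exI[of _ "\<lambda>p\<in>Q. 0"]) auto

definition agree_upto :: "nat \<Rightarrow> labeling \<Rightarrow> labeling \<Rightarrow> bool" where
  "agree_upto d L1 L2 \<longleftrightarrow> (\<forall>(m, n)\<in>Q. m \<le> d \<and> \<bar>n\<bar> \<le> int d \<longrightarrow> label L1 (m, n) = label L2 (m, n))"

text \<open>No point of \<^const>\<open>Q\<close> satisfies \<open>\<bar>n\<bar> \<le> 0\<close>, so \<open>d = 0\<close> always qualifies and natural
  numbers suffice; the supremum is attained, or infinite. Division in \<^typ>\<open>ennreal\<close> satisfies
  \<open>1 / \<infinity> = 0\<close> and \<open>1 / 0 = \<infinity>\<close>.\<close>

definition rho :: "labeling \<Rightarrow> labeling \<Rightarrow> ennreal" where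
  "rho L1 L2 = 1 / ennreal_of_enat (Sup {enat d |d. agree_upto d L1 L2})"

instantiation labeling :: topological_space
begin

definition open_labeling :: "labeling set \<Rightarrow> bool" where
  "open_labeling A \<longleftrightarrow> (\<forall>L\<in>A. \<exists>e>0. \<forall>L'. rho L L' < e \<longrightarrow> L' \<in> A)"

instance
proof
  show "open (UNIV :: labeling set)"
    by (auto simp: open_labeling_def intro: exI[of _ 1])
next
  fix A B :: "labeling set"
  assume A: "open A" and B: "open B"
  show "open (A \<inter> B)"
    unfolding open_labeling_def
  proof
    fix L assume "L \<in> A \<inter> B"
    then obtain e1 e2 where "e1 > 0" "\<forall>L'. rho L L' < e1 \<longrightarrow> L' \<in> A"
      "e2 > 0" "\<forall>L'. rho L L' < e2 \<longrightarrow> L' \<in> B"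
      using A B unfolding open_labeling_def by blast
    then show "\<exists>e>0. \<forall>L'. rho L L' < e \<longrightarrow> L' \<in> A \<inter> B"
      by (intro exI[of _ "min e1 e2"]) auto
  qed
next
  fix K :: "labeling set set"
  assume "\<forall>A\<in>K. open A"
  then show "open (\<Union>K)"
    unfolding open_labeling_def by (meson UnionE UnionI)
qed

end

section \<open>The map from the 2-adic integers to labelings\<close>

text \<open>The two predicates below say that \<open>v\<close> results from some admissible choice (of \<open>z'\<close>,
  respectively of \<open>y'\<close> and then \<open>z'\<close>) in the definition of the label at \<open>(x, z)\<close>.\<close>

definition U_tilde_nat_value :: "nat \<Rightarrow> nat \<Rightarrow> int \<Rightarrow> nat \<Rightarrow> bool" where
  "U_tilde_nat_value y x z v \<longleftrightarrow>
     (y = 0 \<and> v = 1) \<or>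
     (\<exists>k z'. 2 ^ k \<le> y \<and> y < 2 ^ (k + 1) \<and> [int z' = z] (mod 2 ^ (k + 1)) \<and> v = c_ulam y x z')"

definition U_tilde_value :: "two_adic \<Rightarrow> nat \<Rightarrow> int \<Rightarrow> nat \<Rightarrow> bool" where
  "U_tilde_value y x z v \<longleftrightarrow>
     (\<exists>n. y = of_nat n \<and> U_tilde_nat_value n x z v) \<or>
     (y \<notin> \<nat> \<and> (\<exists>y' k. x \<le> y' \<and> \<bar>z\<bar> \<le> int y' \<and> y' < 2 ^ (k + 1) \<and>
                      2 ^ (k + 1) dvd y - of_nat y' \<and> U_tilde_nat_value y' x z v))"

definition U_tilde :: "two_adic \<Rightarrow> labeling" where
  "U_tilde y = Abs_labeling (\<lambda>(x, z)\<in>Q. THE v. U_tilde_value y x z v)"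

end

theory Submission
  imports Defs
begin

text \<open>
  The word \<open>0\<^sup>a10\<^sup>b\<close> is Ulam iff the binary expansions of \<open>a\<close> and \<open>b\<close> have no common digit \<open>1\<close>:
  the only Ulam word without a \<open>1\<close> is \<open>0\<close>, so both properties satisfy Pascal's recursion modulo \<open>2\<close>.
  Hence \<open>c_ulam n x z\<close> counts the \<open>b \<le> n\<close> such that \<open>b\<close> is disjoint from \<open>z\<close> and \<open>n - b\<close> is
  disjoint from \<open>x\<close>. If \<open>z\<close> is replaced by a negative integer congruent to it, disjointness of
  \<open>b\<close> from \<open>z\<close> forces \<open>b < \<bar>z\<bar>\<close>. So for \<open>n \<ge> \<bar>z\<bar>\<close> the range of \<open>b\<close> does not depend on
  \<open>n\<close>, and the count depends only on the residue of \<open>n\<close> modulo a power of \<open>2\<close> exceeding \<open>x\<close>.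
  This yields both independence of the choices and local constancy of every label at
  non-natural points.
\<close>

section \<open>Ulam words with a single one\<close>

lemma length_ulam: "w \<in> ulam n \<Longrightarrow> length w = n \<and> n > 0"
  by (subst (asm) ulam.simps) (auto split: if_splits)

lemma is_ulam_iff_mem: "is_ulam w \<longleftrightarrow> w \<in> ulam (length w)"
  unfolding is_ulam_def using length_ulam by (fastforce simp: Suc_le_eq)

lemma not_is_ulam_Nil [simp]: "\<not> is_ulam []"
  using length_ulam by (fastforce simp: is_ulam_iff_mem)

lemma is_ulam_singleton [simp]: "is_ulam [c]"
  by (cases c) (simp_all add: is_ulam_iff_mem ulam.simps[of "Suc 0"])

text \<open>The empty word is not Ulam, so both factors of a splitting into Ulam words are shorter
  than \<open>w\<close>. This turns the length-indexed recursion into one for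
  \<open>is_ulam\<close>.\<close>

lemma is_ulam_iff_decomposition:
  assumes "length w \<ge> 2"
  shows "is_ulam w \<longleftrightarrow> (\<exists>!(u, v). is_ulam u \<and> is_ulam v \<and> u \<noteq> v \<and> w = u @ v)"
proof -
  have mem: "(\<exists>i\<in>{1..<length w}. s \<in> ulam i) \<longleftrightarrow> is_ulam s \<and> length s < length w" for s
    unfolding is_ulam_iff_mem using length_ulam[of s] by (metis One_nat_def Suc_leI atLeastLessThan_iff)
  have short: "length u < length w \<and> length v < length w" if "is_ulam u" "is_ulam v" "w = u @ v" for u v
    using that by (metis add_less_cancel_left append_Nil2 length_append length_greater_0_conv
        less_add_same_cancel1 less_add_same_cancel2 not_is_ulam_Nil)
  have "is_ulam w \<longleftrightarrow> (\<exists>!(u, v). (\<exists>i\<in>{1..<length w}. u \<in> ulam i) \<and>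
      (\<exists>j\<in>{1..<length w}. v \<in> ulam j) \<and> u \<noteq> v \<and> w = u @ v)"
    using assms unfolding is_ulam_iff_mem by (subst ulam.simps) auto
  also have "\<dots> \<longleftrightarrow> (\<exists>!(u, v). is_ulam u \<and> is_ulam v \<and> u \<noteq> v \<and> w = u @ v)"
    unfolding mem by (rule arg_cong[where f = Ex1]) (use short in auto)
  finally show ?thesis .
qed

section \<open>Ulam words without a 1\<close>

lemma replicate_0_iff: "1 \<notin> set w \<longleftrightarrow> w = replicate (length w) (0 :: bit)"
  by (metis bit.exhaust in_set_replicate replicate_length_same zero_neq_one)

text \<open>By induction both factors of a longer word of zeros would be \<open>[0]\<close>, but
  they must be distinct.\<close>

lemma is_ulam_zeros_iff: "1 \<notin> set w \<Longrightarrow> is_ulam w \<longleftrightarrow> w = [0]"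
proof (induction "length w" arbitrary: w rule: less_induct)
  case less
  show ?case
  proof (cases "length w \<ge> 2")
    case True
    have "False" if "is_ulam u" "is_ulam v" "u \<noteq> v" "w = u @ v" for u v
    proof -
      have "u \<noteq> []" "v \<noteq> []"
        using that by auto
      then have "u = [0]" "v = [0]"
        using less that by auto
      then show False
        using that by simp
    qed
    then have "\<not> is_ulam w"
      unfolding is_ulam_iff_decomposition[OF True] by blast
    then show ?thesis
      using True by auto
  next
    case False
    then consider "w = []" | c where "w = [c]"
      by (cases w rule: remdups_adj.cases) auto
    then show ?thesis
      using less.prems by cases (auto intro: bit.exhaust)
  qed
qed

section \<open>Words with exactly one 1 and their splittings\<close>

lemma zeros_one_append_eq_iff:
  "replicate a (0 :: bit) @ 1 # us = replicate b 0 @ 1 # vs \<longleftrightarrow> a = b \<and> us = vs"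
proof (induction a arbitrary: b)
  case 0
  show ?case
    by (cases b) auto
next
  case (Suc a)
  then show ?case
    by (cases b) auto
qed

definition one_word :: "nat \<Rightarrow> nat \<Rightarrow> bit list" where
  "one_word a b = replicate a 0 @ 1 # replicate b 0"

lemma one_word_eq_iff: "one_word a b = one_word c d \<longleftrightarrow> a = c \<and> b = d"
  by (auto simp: one_word_def zeros_one_append_eq_iff)

lemma one_word_Suc_right: "one_word a (Suc b) = one_word a b @ [0]"
  by (simp add: one_word_def replicate_append_same)

lemma set_one_word: "1 \<in> set (one_word a b)"
  by (simp add: one_word_def)

lemma count_list_zeros [simp]: "count_list (replicate n 0) (1 :: bit) = 0"
  by (auto simp: count_list_0_iff)

lemma count_list_one_iff: "count_list w 1 = 1 \<longleftrightarrow> (\<exists>a b. w = one_word a b)"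
proof
  assume *: "count_list w 1 = 1"
  then have "1 \<in> set w"
    by (metis count_list_0_iff zero_neq_one)
  then obtain us vs where w: "w = us @ 1 # vs"
    by (meson split_list)
  then have "1 \<notin> set us" "1 \<notin> set vs"
    using * by (auto simp: count_list_0_iff)
  then show "\<exists>a b. w = one_word a b"
    unfolding one_word_def w by (metis replicate_0_iff)
qed (auto simp: one_word_def)

text \<open>The single 1 falls into one factor; the other, an Ulam word of zeros, can only be
  \<open>[0]\<close>.\<close>

lemma one_word_eq_append:
  assumes "one_word a b = u @ v" "is_ulam u" "is_ulam v"
  shows "(a > 0 \<and> u = [0] \<and> v = one_word (a - 1) b) \<or> (b > 0 \<and> u = one_word a (b - 1) \<and> v = [0])"
proof -
  have "count_list u 1 + count_list v 1 = 1"
    using count_list_one_iff[of "u @ v"] assms(1) by (metis count_list_append)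
  then consider "1 \<notin> set u" | "1 \<notin> set v"
    by (metis count_list_0_iff One_nat_def add_is_1)
  then show ?thesis
  proof cases
    case 1
    then have "u = [0]"
      using assms is_ulam_zeros_iff by blast
    with assms(1) show ?thesis
      by (cases a) (auto simp: one_word_def)
  next
    case 2
    then have "v = [0]"
      using assms is_ulam_zeros_iff by blast
    with assms(1) show ?thesis
      using one_word_Suc_right[of a "b - 1"] by (cases b) (auto simp: one_word_def[of a 0])
  qed
qed

text \<open>The only candidate splittings strip a leading or a trailing 0, and they are different
  pairs. Uniqueness therefore means that exactly one is valid: an exclusive or, written as
  \<open>\<noteq>\<close>.\<close>

lemma is_ulam_one_word_rec:
  assumes "a + b > 0"
  shows "is_ulam (one_word a b) \<longleftrightarrow>
    (a > 0 \<and> is_ulam (one_word (a - 1) b)) \<noteq> (b > 0 \<and> is_ulam (one_word a (b - 1)))"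
proof -
  let ?L = "a > 0 \<and> is_ulam (one_word (a - 1) b)"
  let ?R = "b > 0 \<and> is_ulam (one_word a (b - 1))"
  let ?D = "\<lambda>(u, v). is_ulam u \<and> is_ulam v \<and> u \<noteq> v \<and> one_word a b = u @ v"
  have ne: "one_word c d \<noteq> [0]" for c d
    using set_one_word[of c d] by auto
  have L: "one_word a b = [0] @ one_word (a - 1) b" if "a > 0"
    using that by (cases a) (auto simp: one_word_def)
  have R: "one_word a b = one_word a (b - 1) @ [0]" if "b > 0"
    using that one_word_Suc_right[of a "b - 1"] by simp
  have D: "?D p \<longleftrightarrow> (?L \<and> p = ([0], one_word (a - 1) b)) \<or> (?R \<and> p = (one_word a (b - 1), [0]))" for p
  proof (cases p)
    case (Pair u v)
    show ?thesis
      unfolding Pair using one_word_eq_append[of a b u v] L R ne by (auto simp: eq_commute[of "[0]"])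
  qed
  have "is_ulam (one_word a b) \<longleftrightarrow> (\<exists>!p. ?D p)"
    using assms by (intro is_ulam_iff_decomposition) (auto simp: one_word_def)
  also have "\<dots> \<longleftrightarrow> ?L \<noteq> ?R"
    unfolding D using ne by auto
  finally show ?thesis .
qed

text \<open>By Kummer's theorem disjointness is oddness of the binomial coefficient
  \<open>a + b\<close> over \<open>a\<close>, so this is Pascal's rule modulo 2. The proof splits by
  parity; the induction hypothesis enters only when both numbers are even and positive, for their
  halves.\<close>

lemma and_eq_0_rec:
  fixes a b :: nat
  assumes "a + b > 0"
  shows "and a b = 0 \<longleftrightarrow> (a > 0 \<and> and (a - 1) b = 0) \<noteq> (b > 0 \<and> and a (b - 1) = 0)"
  using assms
proof (induction "a + b" arbitrary: a b rule: less_induct)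
  case less
  have half: "and c d = 0 \<longleftrightarrow> \<not> (odd c \<and> odd d) \<and> and (c div 2) (d div 2) = 0" for c d :: nat
    by (subst and_rec) auto
  have double: "and (2 * c) (2 * d) = 0 \<longleftrightarrow> and c d = 0" "and (2 * c + 1) (2 * d) = 0 \<longleftrightarrow> and c d = 0"
    "and (2 * c) (2 * d + 1) = 0 \<longleftrightarrow> and c d = 0" "and (2 * c + 1) (2 * d + 1) \<noteq> 0" for c d :: nat
    using half[of "2 * c" "2 * d"] half[of "2 * c + 1" "2 * d"] half[of "2 * c" "2 * d + 1"]
      half[of "2 * c + 1" "2 * d + 1"] by simp_all
  have pred: "2 * Suc c - 1 = 2 * c + 1" "2 * c + 1 - 1 = 2 * c" for c :: nat
    by simp_all
  show ?case
  proof (cases "a = 0 \<or> b = 0")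
    case False
    \<comment> \<open>Positive even numbers are written \<open>2 * Suc d\<close> so that their
      predecessor is \<open>2 * d + 1\<close>.\<close>
    have shape: "(\<exists>d. c = 2 * Suc d) \<or> (\<exists>d. c = 2 * d + 1)" if "c \<noteq> 0" for c :: nat
      using that by presburger
    consider c d where "a = 2 * c + 1" "b = 2 * d + 1" | c d where "a = 2 * Suc c" "b = 2 * d + 1"
      | c d where "a = 2 * c + 1" "b = 2 * Suc d" | c d where "a = 2 * Suc c" "b = 2 * Suc d"
      using shape[of a] shape[of b] False by metis
    then show ?thesis
    proof cases
      case (4 c d)
      then have "and (Suc c) (Suc d) = 0 \<longleftrightarrow> (and c (Suc d) = 0) \<noteq> (and (Suc c) d = 0)"
        using less.hyps[of "Suc c" "Suc d"] by simp
      then show ?thesis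
        unfolding 4 pred double by simp
    qed (simp_all only: pred double, simp_all)
  qed (use less.prems in auto)
qed

lemma is_ulam_one_word_iff: "is_ulam (one_word a b) \<longleftrightarrow> and a b = 0"
proof (induction "a + b" arbitrary: a b rule: less_induct)
  case less
  show ?case
  proof (cases "a + b > 0")
    case True
    then show ?thesis
      unfolding is_ulam_one_word_rec[OF True] and_eq_0_rec[OF True]
      using less[of "a - 1" b] less[of a "b - 1"] by fastforce
  qed (simp add: one_word_def)
qed

text \<open>Here \<open>b\<close> is the number of middle zeros given to the second factor; the cut
  determines the pair, so pairs are counted by \<open>b\<close>.\<close>

lemma c_ulam_eq:
  "c_ulam y x z = min 2 (card {b. b \<le> y \<and> and b z = 0 \<and> and (y - b) x = 0})" (is "_ = min 2 (card ?B)")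
proof -
  let ?f = "\<lambda>b. (one_word x (y - b), one_word b z)"
  have append: "one_word p q @ one_word r s = replicate x 0 @ [1] @ replicate y 0 @ [1] @ replicate z 0
      \<longleftrightarrow> p = x \<and> q + r = y \<and> s = z" for p q r s
  proof -
    have "one_word p q @ one_word r s = replicate p 0 @ 1 # one_word (q + r) s"
      by (simp add: one_word_def replicate_add)
    moreover have "replicate x 0 @ [1] @ replicate y 0 @ [1] @ replicate z 0 = replicate x 0 @ 1 # one_word y z"
      by (simp add: one_word_def)
    ultimately show ?thesis
      by (auto simp: zeros_one_append_eq_iff one_word_eq_iff)
  qed
  have "{(u, v). is_ulam u \<and> is_ulam v \<and> count_list u 1 = 1 \<and> count_list v 1 = 1 \<and>
     u @ v = replicate x 0 @ [1] @ replicate y 0 @ [1] @ replicate z 0} = ?f ` ?B" (is "?S = _")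
  proof (intro subset_antisym subsetI)
    fix t assume "t \<in> ?S"
    then obtain u v where t: "t = (u, v)" "is_ulam u" "is_ulam v"
        "u @ v = replicate x 0 @ [1] @ replicate y 0 @ [1] @ replicate z 0"
      and "count_list u 1 = 1" "count_list v 1 = 1"
      by blast
    then obtain p q r s where "u = one_word p q" "v = one_word r s"
      unfolding count_list_one_iff by blast
    with t have "t = (one_word p q, one_word r s)" "is_ulam (one_word p q)"
        "is_ulam (one_word r s)" "p = x \<and> q + r = y \<and> s = z"
      by (auto simp only: append)
    then show "t \<in> ?f ` ?B"
      by (auto simp: is_ulam_one_word_iff and.commute intro!: image_eqI[of _ _ r])
  next
    fix t assume "t \<in> ?f ` ?B"
    then show "t \<in> ?S"
      using count_list_one_iff append by (auto simp: is_ulam_one_word_iff and.commute)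
  qed
  moreover have "inj_on ?f ?B"
    by (auto simp: inj_on_def one_word_eq_iff)
  ultimately show ?thesis
    unfolding c_ulam_def by (simp add: card_image)
qed

section \<open>Dependence on residues\<close>

text \<open>All digits of \<open>b\<close> lie below position \<open>K\<close>, so it masks the
  higher digits of \<open>z\<close>, also for negative \<open>z\<close> in two's complement.\<close>

lemma and_cong_mod_pow2:
  fixes b z z' :: int
  assumes "0 \<le> b" "b < 2 ^ K" "[z = z'] (mod 2 ^ K)"
  shows "and b z = and b z'"
proof -
  have b: "take_bit K b = b"
    using assms by (simp add: take_bit_int_eq_self)
  have "and (take_bit K b) w = and (take_bit K b) (take_bit K w)" for w
    by (auto simp: bit_eq_iff bit_and_iff bit_take_bit_iff)
  then have "and b w = and b (take_bit K w)" for w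
    by (simp only: b)
  moreover have "take_bit K z = take_bit K z'"
    using assms(3) by (simp add: take_bit_eq_mod cong_def)
  ultimately show ?thesis
    by metis
qed

text \<open>The digits of \<open>b\<close> are among those of \<open>not z\<close>, which is the
  nonnegative number \<open>- z - 1\<close>.\<close>

lemma less_of_and_eq_0:
  fixes b z :: int
  assumes "z < 0" "0 \<le> b" "and b z = 0"
  shows "b < - z"
proof -
  have "and b (not z) = b"
    using assms(3) by (auto simp: bit_eq_iff bit_and_iff bit_not_iff)
  moreover have "and b (not z) \<le> not z"
    using assms(1) by (intro AND_upper2) (simp add: not_int_def)
  ultimately show ?thesis
    by (simp add: not_int_def)
qed

text \<open>For \<open>n \<ge> \<bar>z\<bar>\<close> and \<open>z < 0\<close> this is the common value of all admissible labels. As \<open>m\<close> is an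
  integer, it may be replaced by any integer congruent to it, without regard to signs.\<close>

definition neg_count :: "int \<Rightarrow> nat \<Rightarrow> int \<Rightarrow> nat" where
  "neg_count m x z = min 2 (card {b :: nat. int b < - z \<and> and (int b) z = 0 \<and> and (m - int b) (int x) = 0})"

lemma neg_count_cong:
  assumes "x < 2 ^ K" "[m = m'] (mod 2 ^ K)"
  shows "neg_count m x z = neg_count m' x z"
proof -
  have "and (int x) (m - int b) = and (int x) (m' - int b)" for b
    using assms by (intro and_cong_mod_pow2[of _ K]) (auto intro: cong_diff simp flip: of_nat_less_iff)
  then show ?thesis
    by (simp add: neg_count_def and.commute)
qed

lemma c_ulam_eq_neg_count:
  assumes "z < 0" "\<bar>z\<bar> \<le> int y" "y < 2 ^ K" "[int z' = z] (mod 2 ^ K)"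
  shows "c_ulam y x z' = neg_count (int y) x z"
proof -
  have "b \<le> y \<and> and b z' = 0 \<and> and (y - b) x = 0 \<longleftrightarrow>
      int b < - z \<and> and (int b) z = 0 \<and> and (int y - int b) (int x) = 0" for b
  proof (cases "b \<le> y")
    case True
    have nat_int: "and c d = 0 \<longleftrightarrow> and (int c) (int d) = 0" for c d :: nat
      by (simp flip: of_nat_and_eq)
    have "int b < 2 ^ K"
      using True assms(3) by (simp only: of_nat_less_numeral_power_cancel_iff)
    then have "and (int b) (int z') = and (int b) z"
      using assms(4) by (intro and_cong_mod_pow2) auto
    then show ?thesis
      using True less_of_and_eq_0[OF assms(1), of "int b"] by (auto simp: nat_int of_nat_diff)
  next
    \<comment> \<open>Such a \<open>b\<close> fails the right side too, because
      \<open>- z \<le> int y\<close>.\<close>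
    case False
    then show ?thesis
      using assms by auto
  qed
  then show ?thesis
    unfolding c_ulam_eq neg_count_def by presburger
qed

section \<open>The labels\<close>

lemma pow2_interval_unique:
  fixes y :: nat
  assumes "2 ^ k \<le> y" "y < 2 ^ (k + 1)" "2 ^ j \<le> y" "y < 2 ^ (j + 1)"
  shows "k = j"
proof (rule antisym)
  have "2 ^ k < (2 :: nat) ^ (j + 1)" "2 ^ j < (2 :: nat) ^ (k + 1)"
    using assms by linarith+
  then have "k < j + 1" "j < k + 1"
    by (meson one_less_numeral_iff power_less_imp_less_exp semiring_norm(76))+
  then show "k \<le> j" "j \<le> k"
    by auto
qed

lemma ex_pow2_interval:
  fixes y :: nat
  assumes "y > 0"
  obtains k where "2 ^ k \<le> y" "y < 2 ^ (k + 1)"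
  using ex_power_ivl1[of 2 y] assms by auto

lemma U_tilde_nat_value_ex: "\<exists>v. U_tilde_nat_value y x z v"
proof (cases "y = 0")
  case False
  then obtain k where k: "2 ^ k \<le> y" "y < 2 ^ (k + 1)"
    using ex_pow2_interval by blast
  \<comment> \<open>The least nonnegative residue of \<open>z\<close> serves as
    \<open>z'\<close>.\<close>
  have "[int (nat (z mod 2 ^ (k + 1))) = z] (mod 2 ^ (k + 1))"
    by (simp add: cong_def)
  with k show ?thesis
    unfolding U_tilde_nat_value_def by blast
qed (simp add: U_tilde_nat_value_def)

text \<open>For positive \<open>y\<close> the exponent is determined by \<open>y\<close>, and each
  \<open>b \<le> y\<close> is below \<open>2 ^ (k + 1)\<close>, so it meets only digits of
  \<open>z'\<close> fixed by the congruence.\<close>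

lemma U_tilde_nat_value_unique:
  assumes "U_tilde_nat_value y x z v" "U_tilde_nat_value y x z v'"
  shows "v = v'"
proof (cases "y = 0")
  case True
  with assms show ?thesis
    by (auto simp: U_tilde_nat_value_def)
next
  case False
  with assms obtain k t j s where k: "2 ^ k \<le> y" "y < 2 ^ (k + 1)" "[int t = z] (mod 2 ^ (k + 1))"
      "v = c_ulam y x t" and j: "2 ^ j \<le> y" "y < 2 ^ (j + 1)" "[int s = z] (mod 2 ^ (j + 1))"
      "v' = c_ulam y x s"
    unfolding U_tilde_nat_value_def by blast
  have "j = k"
    using pow2_interval_unique[OF k(1,2) j(1,2)] by simp
  with j(3) have "[int s = int t] (mod 2 ^ (k + 1))"
    using k(3) cong_sym cong_trans by blast
  then have "and (int b) (int s) = and (int b) (int t)" if "b \<le> y" for b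
    using that k(2) by (intro and_cong_mod_pow2[of _ "k + 1"])
      (simp_all only: of_nat_less_numeral_power_cancel_iff of_nat_0_le_iff)
  then have "and b s = and b t" if "b \<le> y" for b
    using that by (metis of_nat_and_eq of_nat_eq_iff)
  then show ?thesis
    unfolding k j c_ulam_eq by (metis (mono_tags, lifting))
qed

lemma U_tilde_nat_value_le_2: "U_tilde_nat_value y x z v \<Longrightarrow> v \<le> 2"
  by (auto simp: U_tilde_nat_value_def c_ulam_def)

lemma U_tilde_nat_value_neg_count:
  assumes "U_tilde_nat_value y x z v" "z < 0" "\<bar>z\<bar> \<le> int y"
  shows "v = neg_count (int y) x z"
  using assms c_ulam_eq_neg_count unfolding U_tilde_nat_value_def by fastforce

lemma U_tilde_value_le_2: "U_tilde_value y x z v \<Longrightarrow> v \<le> 2"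
  by (auto simp: U_tilde_value_def dest: U_tilde_nat_value_le_2)

section \<open>Growth of the residues of a 2-adic integer\<close>

lemma residue_nonneg: "residue y n \<ge> 0"
  by (metis residue_mod pos_mod_sign zero_less_numeral zero_less_power)

lemma residue_less: "residue y n < 2 ^ n"
  by (metis residue_mod pos_mod_bound zero_less_numeral zero_less_power)

lemma residue_mono: "m \<le> n \<Longrightarrow> residue y m \<le> residue y n"
  by (metis residue_le residue_nonneg zmod_le_nonneg_dividend)

text \<open>Residues bounded by \<open>c < 2 ^ N\<close> would stop changing at \<open>N\<close>,
  making \<open>y\<close> the natural number \<open>residue y N\<close>.\<close>

lemma residue_unbounded:
  assumes "y \<notin> \<nat>"
  obtains n where "residue y n \<ge> c"
proof (rule ccontr)
  assume "\<not> thesis"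
  with that have less: "residue y n < c" for n
    by (meson not_le)
  obtain N where N: "c < 2 ^ N"
    using int_one_le_iff_zero_less real_arch_pow[of 2 "real_of_int c"]
    by (metis of_int_less_iff of_int_numeral of_int_power one_less_numeral_iff semiring_norm(76))
  have "residue y n = residue (of_nat (nat (residue y N))) n" for n
  proof (cases "n \<le> N")
    case True
    then have "residue y N mod 2 ^ n = residue y n"
      by (rule residue_le)
    then show ?thesis
      unfolding residue_of_nat by (simp only: int_nat_eq residue_nonneg if_True)
  next
    case False
    then have "residue y n mod 2 ^ N = residue y N"
      by (simp add: residue_le)
    then have "residue y n = residue y N"
      using less[of n] N residue_nonneg[of y n] by simp
    then show ?thesis
      unfolding residue_of_nat by (simp only: int_nat_eq residue_nonneg if_True) (metis residue_mod)
  qed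
  then have "y = of_nat (nat (residue y N))"
    by (rule two_adic_eqI)
  with assms show False
    by (metis of_nat_in_Nats)
qed

text \<open>One formula covers natural and non-natural \<open>w\<close>. It gives uniqueness of
  labels at non-natural points and also compares such a point with its natural neighbours in the
  continuity proof.\<close>

lemma U_tilde_value_neg_count:
  assumes val: "U_tilde_value w x z v" and z: "z < 0"
    and x: "int x \<le> residue w n" and zn: "\<bar>z\<bar> \<le> residue w n"
  shows "v = neg_count (residue w n) x z"
proof -
  have "int x < 2 ^ n"
    using x residue_less[of w n] by linarith
  then have xn: "x < 2 ^ n"
    by (simp only: of_nat_less_numeral_power_cancel_iff)
  show ?thesis
  proof (cases "w \<in> \<nat>")
    case True
    then obtain m where m: "w = of_nat m" "U_tilde_nat_value m x z v"
      using val by (auto simp: U_tilde_value_def)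
    have res: "residue w n = int m mod 2 ^ n"
      by (simp add: m residue_of_nat)
    then have "residue w n \<le> int m"
      by (simp add: zmod_le_nonneg_dividend)
    then have "v = neg_count (int m) x z"
      using U_tilde_nat_value_neg_count[OF m(2) z] zn by linarith
    also have "\<dots> = neg_count (residue w n) x z"
      using xn by (rule neg_count_cong) (simp add: res cong_def)
    finally show ?thesis .
  next
    case False
    then obtain y k where y: "x \<le> y" "\<bar>z\<bar> \<le> int y" "y < 2 ^ (k + 1)" "2 ^ (k + 1) dvd w - of_nat y"
        "U_tilde_nat_value y x z v"
      using val by (auto simp: U_tilde_value_def)
    have res: "residue w (k + 1) = int y"
      using y(3,4) unfolding pow2_dvd_diff_iff residue_of_nat
      by (metis mod_less of_nat_mod of_nat_numeral of_nat_power)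
    \<comment> \<open>Both \<open>residue w n\<close> and \<open>y\<close> are residues of
      \<open>w\<close>, hence congruent at the smaller of the levels \<open>n\<close> and
      \<open>k + 1\<close>; \<open>x\<close> is below both powers.\<close>
    define K where "K = min n (k + 1)"
    have "x < 2 ^ K"
      using xn y(1,3) by (auto simp: K_def min_def)
    moreover have "[int y = residue w n] (mod 2 ^ K)"
      unfolding cong_def res[symmetric] by (simp add: K_def residue_le)
    ultimately show ?thesis
      using neg_count_cong U_tilde_nat_value_neg_count[OF y(5) z y(2)] by metis
  qed
qed

lemma U_tilde_value_ex1:
  assumes "z < 0"
  shows "\<exists>!v. U_tilde_value y x z v"
proof (cases "y \<in> \<nat>")
  case True
  then obtain n where "y = of_nat n"
    by (elim Nats_cases)
  with True have "U_tilde_value y x z v \<longleftrightarrow> U_tilde_nat_value n x z v" for v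
    by (auto simp: U_tilde_value_def)
  then show ?thesis
    using U_tilde_nat_value_ex U_tilde_nat_value_unique by metis
next
  case False
  then obtain n where n: "residue y n \<ge> max (int x) \<bar>z\<bar>"
    using residue_unbounded by blast
  \<comment> \<open>Level \<open>n + 1\<close> matches the exponent \<open>k + 1\<close> in
    \<open>U_tilde_value\<close>.\<close>
  define y' where "y' = nat (residue y (n + 1))"
  have y': "int y' = residue y (n + 1)"
    by (simp add: y'_def residue_nonneg)
  have "residue y (n + 1) \<ge> max (int x) \<bar>z\<bar>"
    using n residue_mono[of n "n + 1" y] by linarith
  then have "x \<le> y'" "\<bar>z\<bar> \<le> int y'"
    using y' by linarith+
  moreover have "int y' < 2 ^ (n + 1)"
    unfolding y' by (rule residue_less)
  then have "y' < 2 ^ (n + 1)"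
    by (simp only: of_nat_less_numeral_power_cancel_iff)
  moreover have "2 ^ (n + 1) dvd y - of_nat y'"
    unfolding pow2_dvd_diff_iff residue_of_nat y' by (rule residue_mod[symmetric])
  ultimately have "\<exists>v. U_tilde_value y x z v"
    using False U_tilde_nat_value_ex[of y' x z] unfolding U_tilde_value_def by blast
  then show ?thesis
    using U_tilde_value_neg_count[OF _ assms] n by (metis max.bounded_iff)
qed

lemma U_tilde_value_label:
  assumes "z < 0"
  shows "U_tilde_value y x z (label (U_tilde y) (x, z))"
proof -
  \<comment> \<open>Stated for all points of \<open>Q\<close>, since inverting
    \<open>Abs_labeling\<close> needs every chosen label to be at most 2.\<close>
  have the: "U_tilde_value y x z (THE v. U_tilde_value y x z v)" if "z < 0" for x z
    using U_tilde_value_ex1[OF that] by (rule theI')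
  have "(\<lambda>(x, z)\<in>Q. THE v. U_tilde_value y x z v) \<in> Q \<rightarrow>\<^sub>E {0, 1, 2}"
  proof
    fix p assume "p \<in> Q"
    then obtain x z where "p = (x, z)" "z < 0"
      by (auto simp: Q_def)
    with \<open>p \<in> Q\<close> show "(\<lambda>(x, z)\<in>Q. THE v. U_tilde_value y x z v) p \<in> {0, 1, 2}"
      using U_tilde_value_le_2[OF the[of z x]] by auto
  qed auto
  then have "label (U_tilde y) (x, z) = (THE v. U_tilde_value y x z v)"
    using assms by (simp add: U_tilde_def Abs_labeling_inverse Q_def)
  with the[OF assms] show ?thesis
    by simp
qed

section \<open>Continuity\<close>

lemma ennreal_inverse_antimono: "a \<le> b \<Longrightarrow> inverse b \<le> inverse (a :: ennreal)"
  including ennreal.lifting by transfer (rule ereal_inverse_antimono)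

lemma rho_le:
  assumes "agree_upto d L L'"
  shows "rho L L' \<le> 1 / of_nat d"
proof -
  have "enat d \<le> Sup {enat d |d. agree_upto d L L'}"
    using assms by (intro Sup_upper) auto
  then have "ennreal_of_enat (enat d) \<le> ennreal_of_enat (Sup {enat d |d. agree_upto d L L'})"
    by (simp only: ennreal_of_enat_le_iff)
  then show ?thesis
    unfolding rho_def divide_ennreal_def by (intro mult_left_mono) (auto simp: ennreal_inverse_antimono)
qed

lemma ex_agree_upto_rho_less:
  assumes "e > 0"
  obtains d where "\<And>L L'. agree_upto d L L' \<Longrightarrow> rho L L' < e"
proof -
  have "\<exists>d. 1 / of_nat d < e"
  proof (cases "e = \<infinity>")
    case True
    then show ?thesis
      by (intro exI[of _ 1]) auto
  next
    case False
    then obtain r where r: "e = ennreal r" "r > 0"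
      using assms by (cases e) auto
    \<comment> \<open>A successor is taken as denominator because \<open>1 / 0\<close> is infinite
      in \<open>ennreal\<close>.\<close>
    obtain d where "inverse (real (Suc d)) < r"
      using reals_Archimedean r(2) by blast
    then have "ennreal (1 / real (Suc d)) < e"
      using r by (simp add: ennreal_less_iff inverse_eq_divide)
    then have "1 / of_nat (Suc d) < e"
      by (simp add: divide_ennreal ennreal_of_nat_eq_real_of_nat flip: ennreal_1 of_nat_Suc)
    then show ?thesis
      by blast
  qed
  then show thesis
    using that rho_le le_less_trans by blast
qed

lemma isCont_U_tilde:
  assumes "y \<notin> \<nat>"
  shows "isCont U_tilde y"
  unfolding isCont_def tendsto_def
proof (intro allI impI)
  fix S :: "labeling set"
  assume "open S" "U_tilde y \<in> S"
  then obtain e where e: "e > 0" "\<And>L. rho (U_tilde y) L < e \<Longrightarrow> L \<in> S"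
    unfolding open_labeling_def by blast
  obtain d where d: "\<And>L L'. agree_upto d L L' \<Longrightarrow> rho L L' < e"
    using ex_agree_upto_rho_less[OF e(1)] by blast
  \<comment> \<open>At this level the residue dominates all \<open>x\<close> and
    \<open>\<bar>z\<bar>\<close> up to \<open>d\<close>, so every label compared below depends on
    \<open>w\<close> only through \<open>residue w n\<close>.\<close>
  obtain n where n: "residue y n \<ge> int d"
    using residue_unbounded[OF assms] by blast
  have "U_tilde w \<in> S" if "dist w y < 1 / 2 ^ n" for w
  proof -
    have "2 ^ n dvd w - y"
      using that dist_two_adic_le_iff less_imp_le by blast
    then have res: "residue w n = residue y n"
      by (simp add: pow2_dvd_diff_iff)
    have "agree_upto d (U_tilde y) (U_tilde w)"
      unfolding agree_upto_def
    proof (intro ballI, clarify)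
      fix x z assume "(x, z) \<in> Q" and xz: "x \<le> d" "\<bar>z\<bar> \<le> int d"
      then have z: "z < 0"
        by (auto simp: Q_def)
      have "int x \<le> residue y n" "\<bar>z\<bar> \<le> residue y n"
        using n xz by linarith+
      then show "label (U_tilde y) (x, z) = label (U_tilde w) (x, z)"
        using U_tilde_value_neg_count[OF U_tilde_value_label[OF z] z, of x y n]
          U_tilde_value_neg_count[OF U_tilde_value_label[OF z] z, of x w n] res by metis
    qed
    then show ?thesis
      using d e(2) by blast
  qed
  then show "\<forall>\<^sub>F w in at y. U_tilde w \<in> S"
    unfolding eventually_at by (intro exI[of _ "1 / 2 ^ n"]) auto
qed

theorem theorem1p16:
  "(\<forall>y. \<forall>(x, z)\<in>Q. \<exists>!v. U_tilde_value y x z v) \<and>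
   (\<forall>y. y \<notin> \<nat> \<longrightarrow> isCont U_tilde y)"
  using U_tilde_value_ex1 isCont_U_tilde by (auto simp: Q_def)

end
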